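(* Let $\mathcal X$ be a finite set with $n\ge 3$ elements and let $\mathrm{cone}(\mathcal A)$ be a maximal elementary simplicial cone of a credal set corresponding to a coherent PRI model $(l,u)$ on $\mathcal X$. Then there exist an enumeration $x_1,\dots,x_n$ of the elements of $\mathcal X$ and an integer $k$ with $1\le k\le n-2$ such that $\mathcal A$ consists of exactly the following $n$ sets: (i) the singletons $A_i=\{x_i\}$ for $1\le i\le k$; (ii) the complements of singletons $A_j=\{x_j\}^c$ for $k+1\le j\le n-1$; (iii) the set $\mathcal X$.
   Context: Real functions on $\mathcal X$ are identified with vectors in $\mathbb R^n$; $\mathbb I_C$ is the indicator vector of $C\subseteq\mathcal X$. A probability interval (PRI) model is a pair $l,u\colon\mathcal X\to\mathbb R$ with $l\le u$; its credal set is $\mathcal M(l,u)=\{P\text{ probability on }\mathcal X\colon l(x)\le P(\{x\})\le u(x)\ \forall x\}$, and it is coherent if $\mathcal M(l,u)\neq\emptyset$ and all the bounds are attained: $l(x)=\min_{P\in\mathcal M(l,u)}P(\{x\})$, $u(x)=\max_{P\in\mathcal M(l,u)}P(\{x\})$. The credal set is described by linear constraints whose support vectors are $\mathbb I_{\{x\}}$ and $\mathbb I_{\{x\}^c}$ ($x\in\mathcal X$), together with the equality constraint for $\mathbb I_{\mathcal X}$. For a collection $\mathcal A$ of sets, $\mathrm{cone}(\mathcal A)=\left\{\sum_{C\in\mathcal A\setminus\{\mathcal X\}}\alpha_C\mathbb I_C+\beta\mathbb I_{\mathcal X}\colon\alpha_C\ge0,\ \beta\in\mathbb R\right\}$. A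 maximal elementary simplicial cone for a PRI model is a cone $\mathrm{cone}(\mathcal A)$ where $\mathcal A$ consists of $\mathcal X$ together with some sets of the form $\{y\}$ or $\{y\}^c$ ($y\in\mathcal X$), the vectors $\mathbb I_C$, $C\in\mathcal A$, form a basis of $\mathbb R^n$, and $\mathbb I_D\notin\mathrm{cone}(\mathcal A)$ for every $D\notin\mathcal A$ of the form $\{y\}$ or $\{y\}^c$. *)

theory Defs
  imports "HOL-Probability.Probability"
begin

text \<open>
  The finite set \<open>\<X>\<close> is the universe of a type of class \<open>finite\<close>, real functions on it are
  vectors in \<open>real ^ 'a\<close>, and probabilities on it are elements of \<open>'a pmf\<close>.
\<close>

definition indvec :: "'a::finite set \<Rightarrow> real ^ 'a" where
  "indvec C = (\<chi> x. indicator C x)"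

definition PRI_model :: "('a::finite \<Rightarrow> real) \<Rightarrow> ('a \<Rightarrow> real) \<Rightarrow> bool" where
  "PRI_model l u \<longleftrightarrow> (\<forall>x. l x \<le> u x)"

definition PRI_credal_set :: "('a::finite \<Rightarrow> real) \<Rightarrow> ('a \<Rightarrow> real) \<Rightarrow> 'a pmf set" where
  "PRI_credal_set l u =
     {P. \<forall>x. l x \<le> measure_pmf.prob P {x} \<and> measure_pmf.prob P {x} \<le> u x}"

definition is_minimum :: "real set \<Rightarrow> real \<Rightarrow> bool" where
  "is_minimum S m \<longleftrightarrow> m \<in> S \<and> (\<forall>s\<in>S. m \<le> s)"

definition is_maximum :: "real set \<Rightarrow> real \<Rightarrow> bool" where
  "is_maximum S m \<longleftrightarrow> m \<in> S \<and> (\<forall>s\<in>S. s \<le> m)"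

definition coherent_PRI :: "('a::finite \<Rightarrow> real) \<Rightarrow> ('a \<Rightarrow> real) \<Rightarrow> bool" where
  "coherent_PRI l u \<longleftrightarrow> PRI_model l u \<and> PRI_credal_set l u \<noteq> {} \<and>
     (\<forall>x. is_minimum ((\<lambda>P. measure_pmf.prob P {x}) ` PRI_credal_set l u) (l x) \<and>
          is_maximum ((\<lambda>P. measure_pmf.prob P {x}) ` PRI_credal_set l u) (u x))"

text \<open>
  The sets whose indicators are the support vectors of the inequality constraints
  \<open>P {x} \<ge> l x\<close> and \<open>P (- {x}) \<ge> 1 - u x\<close>.  They do not depend on the values of \<open>l\<close> and \<open>u\<close>.
\<close>

definition PRI_supports :: "'a::finite set set" where
  "PRI_supports = {{y} | y. True} \<union> {- {y} | y. True}"

text \<open>The coefficient of the indicator of the whole space is unrestricted in sign.\<close>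

definition gen_cone :: "'a::finite set set \<Rightarrow> (real ^ 'a) set" where
  "gen_cone A =
     {(\<Sum>C\<in>A - {UNIV}. \<alpha> C *\<^sub>R indvec C) + \<beta> *\<^sub>R indvec UNIV | \<alpha> \<beta>.
        \<forall>C\<in>A - {UNIV}. 0 \<le> \<alpha> C}"

text \<open>
  A property of the generating collection \<open>A\<close>.  The map \<open>indvec\<close> is injective, so stating
  the basis condition for the image of \<open>A\<close> loses nothing.
\<close>

definition maximal_elementary_simplicial :: "'a::finite set set \<Rightarrow> bool" where
  "maximal_elementary_simplicial A \<longleftrightarrow>
     UNIV \<in> A \<and> A - {UNIV} \<subseteq> PRI_supports \<and>
     independent (indvec ` A) \<and> span (indvec ` A) = UNIV \<and>
     (\<forall>D\<in>PRI_supports. D \<notin> A \<longrightarrow> indvec D \<notin> gen_cone A)"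

end

theory Submission
  imports Defs
begin

text \<open>
  The vectors \<open>\<I>\<^bsub>{y}\<^esub>\<close>, \<open>\<I>\<^bsub>-{y}\<^esub>\<close> and
  \<open>\<I>\<^bsub>UNIV\<^esub>\<close> are linearly dependent, so the \<open>n - 1\<close> sets of \<open>A\<close> other than
  \<open>UNIV\<close> involve \<open>n - 1\<close> different points and miss exactly one point \<open>z\<close>.  Were they all
  singletons, their indicators would sum to \<open>\<I>\<^bsub>-{z}\<^esub>\<close>; were they all complements,
  the sum would be \<open>\<I>\<^bsub>{z}\<^esub> + (n - 2) \<I>\<^bsub>UNIV\<^esub>\<close>.  In either case the cone would
  contain the indicator of a set outside \<open>A\<close>, against maximality.
\<close>

lemma inj_indvec: "inj indvec"
proof (rule injI)
  fix B C :: "'a set"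
  assume "indvec B = indvec C"
  then have "indicator B x = (indicator C x :: real)" for x
    by (simp add: indvec_def vec_eq_iff)
  then show "B = C"
    by (metis indicator_eq_1_iff subsetI subset_antisym)
qed

lemma indvec_Compl: "indvec (- C) = indvec UNIV - indvec C"
  by (simp add: indvec_def vec_eq_iff indicator_def)

lemma indvec_eq_sum_singletons: "indvec B = (\<Sum>y\<in>B. indvec {y})"
  by (simp add: indvec_def vec_eq_iff indicator_def)

lemma singleton_neq_UNIV:
  assumes "3 \<le> CARD('a::finite)"
  shows "{x :: 'a} \<noteq> UNIV"
proof
  assume "{x} = UNIV"
  then have "CARD('a) = card {x}"
    by simp
  then show False
    using assms by simp
qed

text \<open>Equality would leave at most the two points \<open>x\<close> and \<open>y\<close>. With
  three points or more, no support is both a singleton and a complement, so the two kinds can be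
  counted separately.\<close>

lemma singleton_neq_Compl_singleton:
  assumes "3 \<le> CARD('a::finite)"
  shows "{x :: 'a} \<noteq> - {y}"
proof
  assume "{x} = - {y}"
  then have "card (UNIV :: 'a set) = card {x, y}"
    by (intro arg_cong[of _ _ card]) auto
  also have "\<dots> \<le> 2"
    by (simp add: card_insert_if)
  finally show False
    using assms by simp
qed

text \<open>All coefficients are 1; injectivity of \<open>f\<close> lets the sum over points be read
  as a sum over sets. \<open>\<beta>\<close> may have any sign.\<close>

lemma sum_indvec_in_gen_cone:
  assumes "A - {UNIV} = f ` B" "inj_on f B"
  shows "(\<Sum>y\<in>B. indvec (f y)) + \<beta> *\<^sub>R indvec UNIV \<in> gen_cone A"
proof -
  have "(\<Sum>y\<in>B. indvec (f y)) = (\<Sum>C\<in>A - {UNIV}. 1 *\<^sub>R indvec C)"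
    using assms by (simp add: sum.reindex)
  then show ?thesis
    unfolding gen_cone_def mem_Collect_eq
    by (intro exI[of _ "\<lambda>_. 1"] exI[of _ \<beta>]) simp
qed

lemma Compl_singleton_in_gen_cone:
  assumes "A - {UNIV} = (\<lambda>y. {y}) ` (- {z})"
  shows "indvec (- {z}) \<in> gen_cone A"
  using sum_indvec_in_gen_cone[OF assms, of 0] indvec_eq_sum_singletons[of "- {z}"]
  by (simp add: inj_on_def)

lemma singleton_in_gen_cone:
  fixes z :: "'a::finite"
  assumes "A - {UNIV} = (\<lambda>y. - {y}) ` (- {z})"
  shows "indvec {z} \<in> gen_cone A"
proof -
  let ?m = "real (card (- {z}))"
  have "(\<Sum>y\<in>- {z}. indvec (- {y})) = ?m *\<^sub>R indvec UNIV - indvec (- {z})"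
    unfolding indvec_eq_sum_singletons[of "- {z}"]
    by (simp only: indvec_Compl sum_subtractf sum_constant_scaleR)
  \<comment> \<open>Here \<open>?m\<close> is n - 1, so the coefficient \<open>1 - ?m\<close> is -(n
    - 2): this is where a negative multiple of \<open>indvec UNIV\<close> is used.\<close>
  then have "(\<Sum>y\<in>- {z}. indvec (- {y})) + (1 - ?m) *\<^sub>R indvec UNIV = indvec {z}"
    by (simp add: indvec_Compl algebra_simps)
  then show ?thesis
    using sum_indvec_in_gen_cone[OF assms, of "1 - ?m"] by (simp add: inj_on_def)
qed

lemma card_eq_if_indvec_basis:
  fixes A :: "'a::finite set set"
  assumes "independent (indvec ` A)" "span (indvec ` A) = UNIV"
  shows "card A = CARD('a)"
proof -
  have "card (indvec ` A) = dim (UNIV :: (real ^ 'a) set)"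
    using assms by (metis dim_span dim_eq_card_independent)
  moreover have "card (indvec ` A) = card A"
    by (rule card_image) (rule inj_on_subset[OF inj_indvec subset_UNIV])
  ultimately show ?thesis
    by simp
qed

lemma independent_not_singleton_and_Compl:
  fixes A :: "'a::finite set set"
  assumes "3 \<le> CARD('a)" "independent (indvec ` A)" "UNIV \<in> A" "{y} \<in> A"
  shows "- {y} \<notin> A"
proof
  assume "- {y} \<in> A"
  \<comment> \<open>Injectivity of \<open>indvec\<close> and the size of the space keep both vectors
    different from \<open>indvec {y}\<close>, so the linear relation below is a genuine
    dependence.\<close>
  have "{indvec UNIV, indvec (- {y})} \<subseteq> indvec ` A - {indvec {y}}"
    using assms(3) \<open>- {y} \<in> A\<close> singleton_neq_UNIV[OF assms(1)] singleton_neq_Compl_singleton[OF assms(1), of y y]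
    by (auto dest!: injD[OF inj_indvec])
  moreover have "indvec {y} = indvec UNIV - indvec (- {y})"
    by (simp add: indvec_Compl)
  then have "indvec {y} \<in> span {indvec UNIV, indvec (- {y})}"
    by (auto intro: span_diff span_base)
  ultimately have "indvec {y} \<in> span (indvec ` A - {indvec {y}})"
    using span_mono by blast
  then show False
    using assms(2,4) by (auto simp: dependent_def)
qed

text \<open>Bijections onto \<open>S\<close>, \<open>T\<close> and \<open>{z}\<close> are glued
  along consecutive blocks of indices; the missed point \<open>z\<close> comes last, at index
  n.\<close>

lemma ex_enumeration:
  fixes S T :: "'a::finite set"
  assumes "S \<inter> T = {}" "S \<union> T = - {z}"
  shows "\<exists>x :: nat \<Rightarrow> 'a. bij_betw x {1..CARD('a)} UNIV \<and> x ` {1..card S} = S \<and>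
           x ` {card S + 1..CARD('a) - 1} = T"
proof -
  let ?n = "CARD('a)" and ?k = "card S"
  have "card S + card T = ?n - 1"
    using assms card_Un_disjoint[of S T] card_Diff_singleton[of z UNIV]
    by (simp add: Compl_eq_Diff_UNIV[symmetric])
  \<comment> \<open>Rules out truncation in \<open>?n - 1\<close>.\<close>
  moreover have "0 < ?n"
    by simp
  ultimately have n: "?n = Suc (?k + card T)"
    by linarith
  obtain g where g: "bij_betw g {1..?k} S"
    using finite_same_card_bij[of "{1..?k}" S] by auto
  obtain h where h: "bij_betw h {?k + 1..?n - 1} T"
    using finite_same_card_bij[of "{?k + 1..?n - 1}" T] n by auto
  have c: "bij_betw (\<lambda>_. z) {?n} {z}"
    by (simp add: bij_betw_def)
  define x where
    "x i = (if i \<in> {1..?k} then g i else if i \<in> {?k + 1..?n - 1} then h i else z)" for i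
  have x: "bij_betw x ({1..?k} \<union> ({?k + 1..?n - 1} \<union> {?n})) (S \<union> (T \<union> {z}))"
    unfolding x_def using n assms
    by (intro bij_betw_disjoint_Un g h c) auto
  have "{1..?k} \<union> ({?k + 1..?n - 1} \<union> {?n}) = {1..?n}"
    using n by auto
  moreover have "S \<union> (T \<union> {z}) = UNIV"
    using assms by auto
  moreover have "x ` {1..?k} = g ` {1..?k}" "x ` {?k + 1..?n - 1} = h ` {?k + 1..?n - 1}"
    by (auto simp: x_def intro!: image_cong)
  ultimately show ?thesis
    using x g h by (metis bij_betw_imp_surj_on)
qed

theorem proposition10:
  fixes l u :: "'a::finite \<Rightarrow> real" and A :: "'a set set" and n :: nat
  assumes "n = CARD('a)" and "3 \<le> n"
    and "coherent_PRI l u"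
    and "maximal_elementary_simplicial A"
  shows "\<exists>(x :: nat \<Rightarrow> 'a) k. bij_betw x {1..n} UNIV \<and> 1 \<le> k \<and> k \<le> n - 2 \<and>
           A = {{x i} | i. 1 \<le> i \<and> i \<le> k} \<union> {- {x j} | j. k + 1 \<le> j \<and> j \<le> n - 1} \<union> {UNIV} \<and>
           card A = n"
proof -
  define S where "S = {y. {y} \<in> A}"
  define T where "T = {y. - {y} \<in> A}"
  have n3: "3 \<le> CARD('a)"
    using assms by simp
  have univ: "UNIV \<in> A" and supp: "A - {UNIV} \<subseteq> PRI_supports"
    and indep: "independent (indvec ` A)" and span: "span (indvec ` A) = UNIV"
    and outside: "\<And>D. D \<in> PRI_supports \<Longrightarrow> D \<notin> A \<Longrightarrow> indvec D \<notin> gen_cone A"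
    using assms(4) by (auto simp: maximal_elementary_simplicial_def)
  have cardA: "card A = n"
    using card_eq_if_indvec_basis[OF indep span] assms(1) by simp
  have A_eq: "A - {UNIV} = (\<lambda>y. {y}) ` S \<union> (\<lambda>y. - {y}) ` T"
    using supp singleton_neq_UNIV[OF n3] by (auto simp: S_def T_def PRI_supports_def)
  have disj: "S \<inter> T = {}"
    using independent_not_singleton_and_Compl[OF n3 indep univ] by (auto simp: S_def T_def)
  have "n - 1 = card (A - {UNIV})"
    using cardA univ by simp
  also have "\<dots> = card ((\<lambda>y. {y}) ` S) + card ((\<lambda>y. - {y}) ` T)"
    unfolding A_eq using singleton_neq_Compl_singleton[OF n3] by (intro card_Un_disjoint) auto
  also have "\<dots> = card S + card T"
    by (simp add: card_image inj_on_def)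
  finally have cardST: "card S + card T = n - 1"
    by simp
  \<comment> \<open>As \<open>S\<close> and \<open>T\<close> are disjoint, they cover n - 1
    points.\<close>
  then have "card (- (S \<union> T)) = 1"
    using disj assms(1,2) card_Diff_subset[of "S \<union> T" UNIV]
    by (simp add: Compl_eq_Diff_UNIV[symmetric] card_Un_disjoint)
  then obtain z where "- (S \<union> T) = {z}"
    by (auto simp: card_1_singleton_iff)
  then have ST: "S \<union> T = - {z}"
    by auto
  then have z: "{z} \<notin> A" "- {z} \<notin> A"
    by (auto simp: S_def T_def)
  have "S \<noteq> {}"
  proof
    assume "S = {}"
    then show False
      using singleton_in_gen_cone[of A z] outside[of "{z}"] A_eq ST z
      by (auto simp: PRI_supports_def)
  qed
  moreover have "T \<noteq> {}"
  proof
    assume "T = {}"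
    then show False
      using Compl_singleton_in_gen_cone[of A z] outside[of "- {z}"] A_eq ST z
      by (auto simp: PRI_supports_def)
  qed
  ultimately have "0 < card S" "0 < card T"
    by (simp_all add: card_gt_0_iff)
  \<comment> \<open>The number k is \<open>card S\<close>; its upper bound comes from
    \<open>T\<close> being nonempty.\<close>
  then have k: "1 \<le> card S" "card S \<le> n - 2"
    using cardST by linarith+
  obtain x where x: "bij_betw x {1..n} UNIV" "x ` {1..card S} = S" "x ` {card S + 1..n - 1} = T"
    using ex_enumeration[OF disj ST] assms(1) by auto
  have "{{x i} | i. 1 \<le> i \<and> i \<le> card S} = (\<lambda>y. {y}) ` x ` {1..card S}"
    "{- {x j} | j. card S + 1 \<le> j \<and> j \<le> n - 1} = (\<lambda>y. - {y}) ` x ` {card S + 1..n - 1}"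
    by auto
  moreover have "A = (A - {UNIV}) \<union> {UNIV}"
    using univ by blast
  ultimately have "A = {{x i} | i. 1 \<le> i \<and> i \<le> card S} \<union>
      {- {x j} | j. card S + 1 \<le> j \<and> j \<le> n - 1} \<union> {UNIV}"
    by (simp only: A_eq x(2,3))
  with x(1) k cardA show ?thesis
    by blast
qed

end
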